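(* Let $a\ge 2$ and $s\ge 2$ be integers. For every integer $n\ge 2a+1$, $$\mathrm{sat}(n,\mathrm{gn}_s\ge a+1)\le a^2+1.$$
   Context: All graphs are finite, simple and undirected. Guessing number: for an integer $s\ge 2$ and a graph $G$ with vertices $v_1,\dots,v_n$, a protocol is a family $\mathcal P=\{f_i\}_{i=1}^n$ of functions $f_i:\mathbb Z_s^n\to\mathbb Z_s$ such that $f_i(c)$ depends only on the coordinates of $c$ indexed by the neighbors of $v_i$ (not on $v_i$ itself). View $\mathcal P$ as a map $\mathbb Z_s^n\to\mathbb Z_s^n$, $c\mapsto(f_1(c),\dots,f_n(c))$, and let $\mathrm{fix}(\mathcal P)$ be the number of its fixed points. Then $\mathrm{gn}_s(G)=\log_s\max_{\mathcal P}\mathrm{fix}(\mathcal P)$. Saturation: for real $t$, a graph $G$ is $(\mathrm{gn}_s\ge t)$-saturated if $\mathrm{gn}_s(G)<t$ and $\mathrm{gn}_s(G+e)\ge t$ for every non-edge $e$ of $G$ (a pair of distinct non-adjacent vertices of $G$). The saturation number $\mathrm{sat}(n,\mathrm{gn}_s\ge t)$ is the minimum number of edges over all $(\mathrm{gn}_s\ge t)$-saturated graphs on $n$ vertices. *)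

theory Defs
  imports Complex_Main "HOL-Library.FuncSet" "HOL-Library.Extended_Nat"
begin

text \<open>A graph is a pair of a vertex set and a set of two-element sets of vertices.\<close>

definition simple_graph :: "'a set \<Rightarrow> 'a set set \<Rightarrow> bool" where
  "simple_graph V E \<longleftrightarrow> finite V \<and> (\<forall>e\<in>E. e \<subseteq> V \<and> card e = 2)"

definition neighbors :: "'a set \<Rightarrow> 'a set set \<Rightarrow> 'a \<Rightarrow> 'a set" where
  "neighbors V E v = {u \<in> V. {u, v} \<in> E}"

definition nonedges :: "'a set \<Rightarrow> 'a set set \<Rightarrow> 'a set set" where
  "nonedges V E = {e. e \<subseteq> V \<and> card e = 2 \<and> e \<notin> E}"

text \<open>The alphabet \<open>\<int>\<^sub>s\<close> is represented by \<open>{..<s}\<close>: its ring structure plays no role.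
  Configurations are indexed by the vertices themselves instead of by an enumeration of them.\<close>

definition configs :: "nat \<Rightarrow> 'a set \<Rightarrow> ('a \<Rightarrow> nat) set" where
  "configs s V = V \<rightarrow>\<^sub>E {..<s}"

definition is_protocol ::
  "nat \<Rightarrow> 'a set \<Rightarrow> 'a set set \<Rightarrow> ('a \<Rightarrow> ('a \<Rightarrow> nat) \<Rightarrow> nat) \<Rightarrow> bool" where
  "is_protocol s V E f \<longleftrightarrow>
     (\<forall>v\<in>V. f v \<in> configs s V \<rightarrow> {..<s} \<and>
       (\<forall>c\<in>configs s V. \<forall>c'\<in>configs s V.
          (\<forall>u\<in>neighbors V E v. c u = c' u) \<longrightarrow> f v c = f v c'))"

definition protocol_map ::
  "'a set \<Rightarrow> ('a \<Rightarrow> ('a \<Rightarrow> nat) \<Rightarrow> nat) \<Rightarrow> ('a \<Rightarrow> nat) \<Rightarrow> ('a \<Rightarrow> nat)" where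
  "protocol_map V f c = (\<lambda>v\<in>V. f v c)"

definition num_fixed_points ::
  "nat \<Rightarrow> 'a set \<Rightarrow> ('a \<Rightarrow> ('a \<Rightarrow> nat) \<Rightarrow> nat) \<Rightarrow> nat" where
  "num_fixed_points s V f = card {c \<in> configs s V. protocol_map V f c = c}"

text \<open>For finite \<open>V\<close> and \<open>s > 0\<close> the maximum below is over a nonempty set of numbers bounded by
  \<open>s ^ card V\<close>, and it is positive because constant protocols have a fixed point.\<close>

definition guessing_number :: "nat \<Rightarrow> 'a set \<Rightarrow> 'a set set \<Rightarrow> real" where
  "guessing_number s V E =
     log (real s) (real (Max {num_fixed_points s V f | f. is_protocol s V E f}))"

definition gn_saturated :: "nat \<Rightarrow> real \<Rightarrow> 'a set \<Rightarrow> 'a set set \<Rightarrow> bool" where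
  "gn_saturated s t V E \<longleftrightarrow>
     guessing_number s V E < t \<and>
     (\<forall>e\<in>nonedges V E. guessing_number s V (insert e E) \<ge> t)"

text \<open>Vertices are taken from \<open>nat\<close>, which represents every finite graph up to isomorphism.
  The minimum is an infimum in \<open>enat\<close>: it is attained if a saturated graph exists, and it is
  \<open>\<infinity>\<close>, not \<open>0\<close>, if there is none. A finite upper bound thus includes existence.\<close>

definition sat_number :: "nat \<Rightarrow> nat \<Rightarrow> real \<Rightarrow> enat" where
  "sat_number n s t =
     Inf {enat (card E) | (V :: nat set) E.
            simple_graph V E \<and> card V = n \<and> gn_saturated s t V E}"

end

theory Submission
  imports Defs "HOL-Library.Disjoint_Sets"
begin

text \<open>The extremal graph is the complete bipartite graph \<open>K\<^sub>a\<^sub>,\<^sub>a\<close> with parts \<open>A\<close>, \<open>B\<close> in which one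
  edge \<open>xy\<close> is subdivided by a new vertex \<open>z\<close>, plus isolated vertices. Any additional edge creates
  disjoint cliques \<open>K\<close> with \<open>\<Sum>(|K| - 1) = a + 1\<close>: either a triangle and \<open>a - 1\<close> disjoint edges,
  or a matching of size \<open>a + 1\<close>. Guessing on each clique separately then gives \<open>s\<^sup>a\<^sup>+\<^sup>1\<close> fixed points.
  Conversely, suppose that a protocol on the graph itself has \<open>s\<^sup>a\<^sup>+\<^sup>1\<close> fixed points. They are determined
  by their values on \<open>A \<union> {z}\<close>, so all values on this set occur. Hence, for each value of \<open>x\<close>,
  the guess of \<open>z\<close> is a surjective and therefore injective function of the value of \<open>y\<close>. So the values
  on \<open>(B - {y}) \<union> {z}\<close> determine that of \<open>x\<close>, then that of \<open>y\<close>, and then everything else,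
  which leaves at most \<open>s\<^sup>a\<close> fixed points.\<close>

section \<open>Fixed points of a protocol and their restrictions to vertex subsets\<close>

definition fixed_configs :: "nat \<Rightarrow> 'a set \<Rightarrow> ('a \<Rightarrow> ('a \<Rightarrow> nat) \<Rightarrow> nat) \<Rightarrow> ('a \<Rightarrow> nat) set" where
  "fixed_configs s V f = {c \<in> configs s V. protocol_map V f c = c}"

lemma num_fixed_points_eq_card: "num_fixed_points s V f = card (fixed_configs s V f)"
  by (simp add: num_fixed_points_def fixed_configs_def)

lemma finite_configs: "finite V \<Longrightarrow> finite (configs s V)"
  by (simp add: configs_def finite_PiE)

lemma card_configs: "finite V \<Longrightarrow> card (configs s V) = s ^ card V"
  by (simp add: configs_def card_PiE)

lemma finite_fixed_configs: "finite V \<Longrightarrow> finite (fixed_configs s V f)"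
  by (simp add: fixed_configs_def finite_configs)

lemma fixed_configsD:
  assumes "c \<in> fixed_configs s V f"
  shows "c \<in> configs s V" and "v \<in> V \<Longrightarrow> f v c = c v"
  using assms by (auto simp: fixed_configs_def protocol_map_def dest: fun_cong[of _ _ v])

text \<open>A fixed point takes at \<open>v\<close> the value guessed there, and this guess sees
  only the neighbors of \<open>v\<close>. Chains of such deductions yield the injectivity claims
  behind the upper bound.\<close>

lemma fixed_configs_agree:
  assumes "is_protocol s V E f" "c \<in> fixed_configs s V f" "d \<in> fixed_configs s V f" "v \<in> V"
    and "\<And>u. u \<in> neighbors V E v \<Longrightarrow> c u = d u"
  shows "c v = d v"
  using assms fixed_configsD[OF assms(2)] fixed_configsD[OF assms(3)]
  unfolding is_protocol_def by metis

lemma fixed_configs_eqI: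
  assumes "c \<in> fixed_configs s V f" "d \<in> fixed_configs s V f"
    and "\<And>v. v \<in> V \<Longrightarrow> c v = d v"
  shows "c = d"
  using assms fixed_configsD(1)[OF assms(1)] fixed_configsD(1)[OF assms(2)]
  unfolding configs_def by (metis PiE_ext)

lemma restrict_fixed_configs_subset:
  assumes "W \<subseteq> V"
  shows "(\<lambda>c. restrict c W) ` fixed_configs s V f \<subseteq> configs s W"
  using assms by (auto simp: fixed_configs_def configs_def)

lemma card_fixed_configs_le:
  assumes "finite V" "W \<subseteq> V" "inj_on (\<lambda>c. restrict c W) (fixed_configs s V f)"
  shows "card (fixed_configs s V f) \<le> s ^ card W"
proof -
  have "finite W" using assms finite_subset by blast
  then show ?thesis
    using card_inj_on_le[OF assms(3) restrict_fixed_configs_subset[OF assms(2)]]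
    by (simp add: finite_configs card_configs)
qed

text \<open>Equality case of the preceding bound: an injection into a finite set that is not larger
  than its domain is onto.\<close>

lemma restrict_fixed_configs_surj:
  assumes "finite V" "W \<subseteq> V" "inj_on (\<lambda>c. restrict c W) (fixed_configs s V f)"
    and "card (fixed_configs s V f) \<ge> s ^ card W"
  shows "(\<lambda>c. restrict c W) ` fixed_configs s V f = configs s W"
proof -
  have "finite W" using assms finite_subset by blast
  then show ?thesis
    using assms restrict_fixed_configs_subset[OF assms(2)]
    by (intro card_seteq) (auto simp: finite_configs card_configs card_image)
qed

section \<open>From fixed point counts to guessing numbers\<close>

lemma finite_num_fixed_points:
  assumes "finite V"
  shows "finite {num_fixed_points s V f | f. is_protocol s V E f}"
proof (rule finite_subset)
  show "{num_fixed_points s V f | f. is_protocol s V E f} \<subseteq> {..s ^ card V}"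
    using assms by (auto simp: num_fixed_points_def card_configs[symmetric]
        intro!: card_mono finite_configs)
qed simp

lemma guessing_number_ge:
  assumes "finite V" "s \<ge> 2" "is_protocol s V E f" "s ^ k \<le> num_fixed_points s V f"
  shows "real k \<le> guessing_number s V E"
proof -
  define M where "M = Max {num_fixed_points s V f | f. is_protocol s V E f}"
  have "num_fixed_points s V f \<le> M"
    unfolding M_def using assms(3) by (intro Max_ge finite_num_fixed_points[OF assms(1)]) blast
  with assms(4) have le: "s ^ k \<le> M" by (rule order_trans)
  moreover have "0 < s ^ k" using assms(2) by simp
  ultimately have "0 < M" by linarith
  from le have "real s ^ k \<le> real M" by (metis of_nat_le_iff of_nat_power)
  with \<open>0 < M\<close> show ?thesis
    using assms(2) unfolding guessing_number_def M_def[symmetric]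
    by (subst le_log_iff) (auto simp: powr_realpow)
qed

lemma guessing_number_less:
  assumes "finite V" "s \<ge> 2" "k > 0"
    and "\<And>f. is_protocol s V E f \<Longrightarrow> num_fixed_points s V f < s ^ k"
  shows "guessing_number s V E < real k"
proof -
  define S where "S = {num_fixed_points s V f | f. is_protocol s V E f}"
  have "is_protocol s V E (\<lambda>_ _. 0)" using assms(2) by (auto simp: is_protocol_def)
  then have "S \<noteq> {}" unfolding S_def by blast
  then have "Max S \<in> S" unfolding S_def by (intro Max_in finite_num_fixed_points assms(1))
  moreover have "\<forall>m\<in>S. m < s ^ k" unfolding S_def using assms(4) by blast
  ultimately have "Max S < s ^ k" by blast
  then have less: "real (Max S) < real s ^ k" by (metis of_nat_less_iff of_nat_power)
  show ?thesis
  proof (cases "Max S = 0")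
    \<comment> \<open>Here \<open>log_def\<close> and the convention that the logarithm of 0 is 0
      leave \<open>0 < k\<close>, so no fixed point has to be exhibited.\<close>
    case True
    then show ?thesis using assms(3) by (simp add: guessing_number_def S_def[symmetric] log_def)
  next
    case False
    then show ?thesis
      using assms(2) less unfolding guessing_number_def S_def[symmetric]
      by (subst log_less_iff) (auto simp: powr_realpow)
  qed
qed

section \<open>Lower bounds from disjoint cliques\<close>

definition clique :: "'a set set \<Rightarrow> 'a set \<Rightarrow> bool" where
  "clique E K \<longleftrightarrow> (\<forall>u\<in>K. \<forall>v\<in>K. u \<noteq> v \<longrightarrow> {u, v} \<in> E)"

text \<open>On each clique the players guess that the values sum to \<open>0\<close> modulo \<open>s\<close>; a fixed point
  is then determined by free values on all but one vertex of each clique.\<close>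

lemma guessing_number_ge_clique_packing:
  assumes fin: "finite V" and s: "s \<ge> 2" and dis: "disjoint C"
    and C: "\<And>K. K \<in> C \<Longrightarrow> K \<subseteq> V \<and> K \<noteq> {} \<and> clique E K"
  shows "real (\<Sum>K\<in>C. card K - 1) \<le> guessing_number s V E"
proof -
  \<comment> \<open>By disjointness this union is the one clique containing \<open>v\<close>. It is
    empty if no clique covers \<open>v\<close>, and then \<open>v\<close> guesses 0.\<close>
  define cls where "cls v = \<Union>{K \<in> C. v \<in> K}" for v
  define f where "f v c = nat ((- (\<Sum>u\<in>cls v - {v}. int (c u))) mod int s)"
    for v and c :: "'a \<Rightarrow> nat"
  have cls: "cls v = K" if "K \<in> C" "v \<in> K" for v K
    using that dis unfolding cls_def disjoint_def by blast
  have cls_nbrs: "u \<in> neighbors V E v" if "u \<in> cls v - {v}" for u v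
  proof -
    from that obtain K where "K \<in> C" "v \<in> K" "u \<in> K" "u \<noteq> v" by (auto simp: cls_def)
    with C[of K] show ?thesis by (auto simp: neighbors_def clique_def)
  qed
  have f_less: "f v c < s" for v c using s by (simp add: f_def nat_less_iff)
  have f_cong: "f v c = f v d" if "\<And>u. u \<in> cls v - {v} \<Longrightarrow> c u = d u" for v c d
    using that by (simp add: f_def)
  have prot: "is_protocol s V E f"
    unfolding is_protocol_def
  proof (intro ballI conjI impI)
    show "f v c = f v d" if "\<forall>u\<in>neighbors V E v. c u = d u" for v c d
      using that cls_nbrs by (intro f_cong) blast
  qed (use f_less in auto)
  \<comment> \<open>Each clique gives up one representative, whose value is forced by the others;
    \<open>D\<close> collects the remaining, free vertices.\<close>
  define r where "r K = (SOME v. v \<in> K)" for K :: "'a set"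
  have r: "r K \<in> K" if "K \<in> C" for K
  proof -
    have "K \<noteq> {}" using C[OF that] by simp
    then show ?thesis unfolding r_def by (rule some_in_eq[THEN iffD2])
  qed
  define D where "D = (\<Union>K\<in>C. K - {r K})"
  have D_iff: "v \<in> D \<longleftrightarrow> v \<noteq> r K" if "K \<in> C" "v \<in> K" for v K
  proof -
    have "K' = K" if "K' \<in> C" "v \<in> K'" for K'
      using cls[OF that] cls[OF \<open>K \<in> C\<close> \<open>v \<in> K\<close>] by simp
    then show ?thesis using that unfolding D_def by blast
  qed
  have DV: "D \<subseteq> V" using C by (auto simp: D_def)
  have finC: "finite C" using C fin by (meson PowI finite_Pow_iff finite_subset subsetI)
  have finK: "finite K" if "K \<in> C" for K using C[OF that] fin finite_subset by blast
  have "card D = (\<Sum>K\<in>C. card (K - {r K}))"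
    unfolding D_def
    by (rule card_UN_disjoint) (use finC finK dis in \<open>auto simp: disjoint_def\<close>)
  also have "\<dots> = (\<Sum>K\<in>C. card K - 1)"
    by (rule sum.cong) (auto simp: r finK)
  finally have cardD: "card D = (\<Sum>K\<in>C. card K - 1)" .
  \<comment> \<open>Evaluating \<open>f v\<close> at \<open>d\<close>, which is prescribed only on
    \<open>D\<close>, is harmless: the other members of the clique of a representative all lie in
    \<open>D\<close>, and an uncovered vertex consults nobody.\<close>
  define ext where "ext d = (\<lambda>v\<in>V. if v \<in> D then d v else f v d)" for d
  have "ext d \<in> fixed_configs s V f" if d: "d \<in> configs s D" for d
  proof -
    have dl: "d v < s" if "v \<in> D" for v using d that by (auto simp: configs_def)
    have conf: "ext d \<in> configs s V" using f_less dl by (auto simp: ext_def configs_def)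
    have "f v (ext d) = ext d v" if v: "v \<in> V" for v
    proof (cases "v \<in> D")
      case False
      have "f v (ext d) = f v d"
      proof (rule f_cong)
        fix u assume "u \<in> cls v - {v}"
        then obtain K where K: "K \<in> C" "v \<in> K" "u \<in> K" "u \<noteq> v" by (auto simp: cls_def)
        with False D_iff have "u \<in> D" by metis
        with DV show "ext d u = d u" by (auto simp: ext_def)
      qed
      with False v show ?thesis by (simp add: ext_def)
    next
      case True
      then obtain K where K: "K \<in> C" "v \<in> K" "v \<noteq> r K" by (auto simp: D_def)
      have KV: "K \<subseteq> V" using C K by blast
      \<comment> \<open>A free vertex sees the representative, which carries minus the sum of
        \<open>d v\<close> and the values on \<open>?R\<close>, and \<open>?R\<close> itself. The
        latter cancels, so the guess is \<open>d v\<close>.\<close>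
      let ?R = "K - {v} - {r K}"
      have inD: "u \<in> D" if "u \<in> K" "u \<noteq> r K" for u using that K D_iff by metis
      have extR: "ext d u = d u" if "u \<in> K" "u \<noteq> r K" for u
        using inD[OF that] KV that by (auto simp: ext_def)
      have ext_r: "int (ext d (r K)) = (- (\<Sum>u\<in>K - {r K}. int (d u))) mod int s"
        using D_iff[OF K(1) r[OF K(1)]] KV r[OF K(1)] s
        by (auto simp: ext_def f_def cls[OF K(1) r[OF K(1)]])
      have split_r: "(\<Sum>u\<in>K - {r K}. int (d u)) = int (d v) + (\<Sum>u\<in>?R. int (d u))"
        using K finK[OF K(1)] by (subst sum.remove[of _ v]) (auto intro!: sum.cong)
      have "(\<Sum>u\<in>K - {v}. int (ext d u)) = int (ext d (r K)) + (\<Sum>u\<in>?R. int (ext d u))"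
        using K finK[OF K(1)] r[OF K(1)] by (subst sum.remove[of _ "r K"]) auto
      also have "(\<Sum>u\<in>?R. int (ext d u)) = (\<Sum>u\<in>?R. int (d u))"
        by (rule sum.cong) (auto simp: extR)
      finally have "(- (\<Sum>u\<in>K - {v}. int (ext d u))) mod int s
          = (- ((- (int (d v) + (\<Sum>u\<in>?R. int (d u)))) mod int s + (\<Sum>u\<in>?R. int (d u)))) mod int s"
        by (simp add: ext_r split_r)
      also have "\<dots> = (- (- (int (d v) + (\<Sum>u\<in>?R. int (d u))) + (\<Sum>u\<in>?R. int (d u)))) mod int s"
        by (intro mod_minus_cong) (simp only: mod_add_left_eq)
      also have "\<dots> = int (d v)" using dl[OF True] by simp
      finally show ?thesis using True v by (simp add: f_def cls[OF K(1,2)] ext_def)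
    qed
    with conf show ?thesis
      by (auto simp: fixed_configs_def protocol_map_def configs_def fun_eq_iff)
  qed
  moreover have "inj_on ext (configs s D)"
  proof (rule inj_onI)
    fix d d' assume d: "d \<in> configs s D" "d' \<in> configs s D" and eq: "ext d = ext d'"
    have "d v = d' v" if "v \<in> D" for v
      using fun_cong[OF eq, of v] that DV by (auto simp: ext_def)
    with d show "d = d'" unfolding configs_def by (metis PiE_ext)
  qed
  ultimately have "card (configs s D) \<le> num_fixed_points s V f"
    unfolding num_fixed_points_eq_card using fin
    by (intro card_inj_on_le) (auto simp: finite_fixed_configs)
  then have "s ^ (\<Sum>K\<in>C. card K - 1) \<le> num_fixed_points s V f"
    using DV fin by (simp add: card_configs finite_subset cardD)
  with fin s prot show ?thesis by (rule guessing_number_ge)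
qed

text \<open>A bijection from \<open>P\<close> to \<open>Q\<close> gives \<open>card P\<close>
  disjoint edges, each contributing 1 to the packing sum. Applications then list only the few
  exceptional cliques in \<open>C\<close>.\<close>

lemma guessing_number_ge_cliques_bipartite:
  assumes fin: "finite V" and s: "s \<ge> 2" and dis: "disjoint C"
    and C: "\<And>K. K \<in> C \<Longrightarrow> K \<subseteq> V \<and> K \<noteq> {} \<and> clique E K"
    and PQ: "P \<subseteq> V" "Q \<subseteq> V" "P \<inter> Q = {}" "card P = card Q" "\<Union>C \<inter> (P \<union> Q) = {}"
    and E: "\<And>u v. u \<in> P \<Longrightarrow> v \<in> Q \<Longrightarrow> {u, v} \<in> E"
  shows "real ((\<Sum>K\<in>C. card K - 1) + card P) \<le> guessing_number s V E"
proof -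
  have finPQ: "finite P" "finite Q" using PQ fin finite_subset by blast+
  then obtain g where g: "bij_betw g P Q" using PQ(4) finite_same_card_bij by blast
  define M where "M = (\<lambda>u. {u, g u}) ` P"
  have gQ: "g u \<in> Q" if "u \<in> P" for u using g that bij_betwE by blast
  have g_inj: "g u = g v \<longleftrightarrow> u = v" if "u \<in> P" "v \<in> P" for u v
    using g that by (auto simp: bij_betw_def inj_on_def)
  have neq: "u \<noteq> g v" if "u \<in> P" "v \<in> P" for u v using gQ PQ(3) that by blast
  have sumM: "(\<Sum>K\<in>M. card K - 1) = card P"
  proof -
    have "inj_on (\<lambda>u. {u, g u}) P"
      using neq by (auto simp: inj_on_def doubleton_eq_iff)
    then have "(\<Sum>K\<in>M. card K - 1) = (\<Sum>u\<in>P. card {u, g u} - 1)"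
      by (simp add: M_def sum.reindex)
    also have "\<dots> = (\<Sum>u\<in>P. 1)" by (rule sum.cong) (use neq in auto)
    finally show ?thesis by simp
  qed
  have finC: "finite C" using C fin by (meson PowI finite_Pow_iff finite_subset subsetI)
  have "M \<inter> C = {}" using PQ(5) by (auto simp: M_def)
  then have "(\<Sum>K\<in>C \<union> M. card K - 1) = (\<Sum>K\<in>C. card K - 1) + card P"
    using finC finPQ by (subst sum.union_disjoint) (auto simp flip: sumM simp: M_def)
  moreover have "disjoint (C \<union> M)"
  proof (rule disjoint_union)
    show "disjoint M"
      using neq g_inj by (fastforce simp: disjoint_def M_def)
    show "\<Union>C \<inter> \<Union>M = {}" using PQ(5) gQ by (auto simp: M_def)
  qed (fact dis)
  moreover have "K \<subseteq> V \<and> K \<noteq> {} \<and> clique E K" if K: "K \<in> C \<union> M" for K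
  proof (cases "K \<in> C")
    case False
    with K obtain u where u: "u \<in> P" "K = {u, g u}" by (auto simp: M_def)
    have "{u, g u} \<in> E" using u gQ E by blast
    then show ?thesis using u gQ[OF u(1)] PQ(1,2) by (auto simp: clique_def insert_commute)
  qed (simp add: C)
  ultimately show ?thesis
    using guessing_number_ge_clique_packing[OF fin s, of "C \<union> M" E] by auto
qed

section \<open>The subdivided complete bipartite graph\<close>

definition subdivided_biclique :: "'a set \<Rightarrow> 'a set \<Rightarrow> 'a \<Rightarrow> 'a \<Rightarrow> 'a \<Rightarrow> 'a set set" where
  "subdivided_biclique A B x y z =
     (\<lambda>(u, v). {u, v}) ` (A \<times> B - {(x, y)}) \<union> {{x, z}, {y, z}}"

text \<open>With this symmetry, facts proved for the side \<open>A\<close> carry over to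
  \<open>B\<close>.\<close>

lemma subdivided_biclique_commute:
  "subdivided_biclique A B x y z = subdivided_biclique B A y x z"
proof -
  have "subdivided_biclique A B x y z \<subseteq> subdivided_biclique B A y x z" for A B :: "'a set" and x y
    by (fastforce simp: subdivided_biclique_def insert_commute)
  then show ?thesis by (simp add: antisym)
qed

lemma card_subdivided_biclique_le:
  assumes "finite A" "finite B" "x \<in> A" "y \<in> B"
  shows "card (subdivided_biclique A B x y z) \<le> card A * card B + 1"
proof -
  have "card (subdivided_biclique A B x y z) \<le>
      card ((\<lambda>(u, v). {u, v}) ` (A \<times> B - {(x, y)})) + card {{x, z}, {y, z}}"
    unfolding subdivided_biclique_def by (rule card_Un_le)
  also have "card ((\<lambda>(u, v). {u, v}) ` (A \<times> B - {(x, y)})) \<le> card (A \<times> B - {(x, y)})"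
    using assms by (intro card_image_le) auto
  also have "card (A \<times> B - {(x, y)}) = card A * card B - 1"
    using assms by (simp add: card_cartesian_product)
  also have "card {{x, z}, {y, z}} \<le> 2"
    by (simp add: card_insert_if)
  \<comment> \<open>Deleting \<open>(x, y)\<close> costs one edge and the path through
    \<open>z\<close> adds two. The product of the cardinalities is positive, so the truncated
    subtraction is exact.\<close>
  finally show ?thesis using assms card_gt_0_iff[of A] card_gt_0_iff[of B]
    by (cases "card A * card B") auto
qed

text \<open>Vertices of \<open>V\<close> outside \<open>A\<close>, \<open>B\<close> and
  \<open>z\<close> will be isolated. The assumptions are invariant under exchanging \<open>A\<close>
  with \<open>B\<close> and \<open>x\<close> with \<open>y\<close>.\<close>

locale subdivided_biclique_graph =
  fixes V A B :: "'a set" and x y z :: 'a and s :: nat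
  assumes finite_V: "finite V" and s: "s \<ge> 2"
    and AV: "A \<subseteq> V" and BV: "B \<subseteq> V" and AB: "A \<inter> B = {}" and card_AB: "card A = card B"
    and x: "x \<in> A" and y: "y \<in> B" and z: "z \<in> V" "z \<notin> A" "z \<notin> B"
begin

abbreviation "E \<equiv> subdivided_biclique A B x y z"

lemma swapped: "subdivided_biclique_graph V B A y x z s"
  using finite_V s AV BV AB card_AB x y z by unfold_locales auto

lemma finite_AB: "finite A" "finite B"
  using finite_V AV BV finite_subset by blast+

lemma biclique_edge: "u \<in> A \<Longrightarrow> v \<in> B \<Longrightarrow> u \<noteq> x \<or> v \<noteq> y \<Longrightarrow> {u, v} \<in> E"
  by (auto simp: subdivided_biclique_def)

lemma subdivision_edges: "{x, z} \<in> E" "{y, z} \<in> E"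
  by (auto simp: subdivided_biclique_def)

lemma simple_graph: "simple_graph V E"
proof -
  have "x \<noteq> z" "y \<noteq> z" "\<And>u v. u \<in> A \<Longrightarrow> v \<in> B \<Longrightarrow> u \<noteq> v" using AB x y z by auto
  then show ?thesis
    using finite_V AV BV x y z by (auto simp: simple_graph_def subdivided_biclique_def)
qed

lemma neighbors_z: "neighbors V E z \<subseteq> {x, y}"
  using z by (auto simp: neighbors_def subdivided_biclique_def doubleton_eq_iff)

lemma neighbors_x: "neighbors V E x \<subseteq> insert z (B - {y})"
  using x y z AB by (auto simp: neighbors_def subdivided_biclique_def doubleton_eq_iff)

lemma neighbors_A: "u \<in> A - {x} \<Longrightarrow> neighbors V E u \<subseteq> B"
  using x y z AB by (auto simp: neighbors_def subdivided_biclique_def doubleton_eq_iff)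

lemma neighbors_isolated: "u \<notin> A \<union> B \<union> {z} \<Longrightarrow> neighbors V E u = {}"
  using x y z AB by (auto simp: neighbors_def subdivided_biclique_def doubleton_eq_iff)

text \<open>Instances of the locale with the sides exchanged; folding turns the exchanged edge set
  back into \<open>E\<close>.\<close>

lemmas neighbors_y = subdivided_biclique_graph.neighbors_x
  [OF swapped, folded subdivided_biclique_commute[of A B x y z]]

lemmas neighbors_B = subdivided_biclique_graph.neighbors_A
  [OF swapped, folded subdivided_biclique_commute[of A B x y z]]

section \<open>Upper bound on the number of fixed points\<close>

lemma num_fixed_points_less:
  assumes f: "is_protocol s V E f"
  shows "num_fixed_points s V f < s ^ (card A + 1)"
proof (rule ccontr)
  let ?F = "fixed_configs s V f"
  assume "\<not> ?thesis"
  then have ge: "card ?F \<ge> s ^ (card A + 1)" by (simp add: num_fixed_points_eq_card)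
  note agree = fixed_configs_agree[OF f]
  have isolated: "c v = d v" if "c \<in> ?F" "d \<in> ?F" "v \<in> V" "v \<notin> A \<union> B \<union> {z}" for c d v
    using agree[OF that(1-3)] neighbors_isolated[OF that(4)] by blast
  \<comment> \<open>Every vertex of \<open>B\<close> has all its neighbors in
    \<open>insert z A\<close>.\<close>
  have inj1: "inj_on (\<lambda>c. restrict c (insert z A)) ?F"
  proof (rule inj_onI)
    fix c d assume cd: "c \<in> ?F" "d \<in> ?F"
      and eq: "restrict c (insert z A) = restrict d (insert z A)"
    have cA: "c v = d v" if "v \<in> insert z A" for v
      using fun_cong[OF eq, of v] that by auto
    have cB: "c v = d v" if "v \<in> B" for v
    proof (rule agree[OF cd])
      show "v \<in> V" using that BV by auto
      show "c u = d u" if "u \<in> neighbors V E v" for u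
        using that \<open>v \<in> B\<close> neighbors_y neighbors_B[of v] cA by (cases "v = y") auto
    qed
    show "c = d"
      using cA cB isolated[OF cd] by (intro fixed_configs_eqI[OF cd]) blast
  qed
  have card_zA: "card (insert z A) = card A + 1" using z finite_AB by simp
  have surj: "(\<lambda>c. restrict c (insert z A)) ` ?F = configs s (insert z A)"
    using restrict_fixed_configs_surj[OF finite_V _ inj1] AV z ge card_zA by simp
  \<comment> \<open>All that is used of surjectivity: the values at \<open>x\<close> and
    \<open>z\<close> can be prescribed independently.\<close>
  have attained: "\<exists>c\<in>?F. c x = i \<and> c z = k" if "i < s" "k < s" for i k
  proof -
    have "(\<lambda>v\<in>insert z A. if v = z then k else i) \<in> configs s (insert z A)"
      using that by (auto simp: configs_def)
    then obtain c where c: "c \<in> ?F"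
      and eq: "(\<lambda>v\<in>insert z A. if v = z then k else i) = restrict c (insert z A)"
      using surj by (metis (no_types, lifting) imageE)
    show ?thesis
      using fun_cong[OF eq, of x] fun_cong[OF eq, of z] x z c by (auto split: if_splits)
  qed
  have val: "c v < s" if "c \<in> ?F" "v \<in> V" for c v
    using fixed_configsD(1)[OF that(1)] that(2) by (auto simp: configs_def)
  have inj2: "inj_on (\<lambda>c. restrict c (insert z (B - {y}))) ?F"
  proof (rule inj_onI)
    fix c d assume cd: "c \<in> ?F" "d \<in> ?F"
      and eq: "restrict c (insert z (B - {y})) = restrict d (insert z (B - {y}))"
    have c1: "c v = d v" if "v \<in> insert z (B - {y})" for v
      using fun_cong[OF eq, of v] that by auto
    have cx: "c x = d x" using agree[OF cd, of x] neighbors_x c1 x AV by blast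
    \<comment> \<open>The guess of \<open>z\<close> as a function of the value at \<open>y\<close>
      alone, with \<open>x\<close> held at \<open>c x\<close>. The rest of \<open>c\<close> is only
      a template, since \<open>z\<close> sees at most \<open>x\<close> and \<open>y\<close>.\<close>
    define g where "g j = f z (c(y := j))" for j
    have upd: "c(y := j) \<in> configs s V" if "j < s" for j
      using fixed_configsD(1)[OF cd(1)] that y BV by (auto simp: configs_def PiE_def extensional_def)
    have g: "e z = g (e y)" if e: "e \<in> ?F" and ex: "e x = c x" for e
    proof -
      have "f z e = f z (c(y := e y))"
      proof -
        have "\<forall>u\<in>neighbors V E z. e u = (c(y := e y)) u" using neighbors_z ex by auto
        then show ?thesis
          using f fixed_configsD(1)[OF e] upd[OF val[OF e]] y BV z(1)
          unfolding is_protocol_def by blast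
      qed
      then show ?thesis using fixed_configsD(2)[OF e z(1)] by (simp add: g_def)
    qed
    have "{..<s} \<subseteq> g ` {..<s}"
    proof
      fix k assume "k \<in> {..<s}"
      then obtain e where e: "e \<in> ?F" "e x = c x" "e z = k"
        using attained val[OF cd(1)] x AV by (metis lessThan_iff subsetD)
      then show "k \<in> g ` {..<s}" using g[OF e(1,2)] val[OF e(1), of y] y BV by auto
    qed
    then have "inj_on g {..<s}" by (intro finite_surj_inj) auto
    \<comment> \<open>Both sides are the common value of \<open>c\<close> and \<open>d\<close> at
      \<open>z\<close>.\<close>
    moreover have "g (c y) = g (d y)" using g[OF cd(1)] g[OF cd(2)] cx c1 by simp
    ultimately have cy: "c y = d y"
      using val[OF cd(1), of y] val[OF cd(2), of y] y BV by (auto simp: inj_on_def)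
    have cB: "c v = d v" if "v \<in> insert z B" for v using c1 cy that by (cases "v = y") auto
    have cA: "c v = d v" if "v \<in> A" for v
    proof (cases "v = x")
      case False
      then have "neighbors V E v \<subseteq> B" using that neighbors_A by blast
      moreover have "v \<in> V" using that AV by blast
      ultimately show ?thesis using agree[OF cd] cB by blast
    qed (simp add: cx)
    show "c = d"
      using cA cB isolated[OF cd] by (intro fixed_configs_eqI[OF cd]) blast
  qed
  \<comment> \<open>Trading \<open>y\<close> for \<open>z\<close> leaves one vertex fewer than in
    \<open>insert z A\<close>, which gives the contradiction.\<close>
  have "card (insert z (B - {y})) = card A"
    using y z finite_AB card_AB card_gt_0_iff[of B] by auto
  then have "card ?F \<le> s ^ card A"
    using card_fixed_configs_le[OF finite_V _ inj2] BV z(1) by auto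
  moreover have "s ^ card A < s ^ (card A + 1)" using s by simp
  ultimately show False using ge by linarith
qed

section \<open>Clique packings after adding an edge\<close>

lemma clique_pair: "{u, v} \<in> F \<Longrightarrow> clique F {u, v}"
  by (auto simp: clique_def insert_commute)

lemma clique_triangle: "{u, v} \<in> F \<Longrightarrow> {u, w} \<in> F \<Longrightarrow> {v, w} \<in> F \<Longrightarrow> clique F {u, v, w}"
  by (auto simp: clique_def insert_commute)

lemma obtain_other:
  assumes "card A \<ge> 2"
  obtains v where "v \<in> B" "v \<noteq> y"
proof -
  have "card (B - {y}) > 0" using assms card_AB y finite_AB by simp
  then show ?thesis using that by (metis Diff_iff all_not_in_conv card_gt_0_iff singletonI)
qed

text \<open>The condition on \<open>x\<close> and \<open>y\<close> keeps the missing edge out of the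
  pairs between \<open>P\<close> and \<open>Q\<close>, so these sets are completely joined.\<close>

lemma guessing_number_insert_ge:
  assumes "disjoint C" "\<And>K. K \<in> C \<Longrightarrow> K \<subseteq> V \<and> K \<noteq> {} \<and> clique (insert e E) K"
    and "P \<subseteq> A" "Q \<subseteq> B" "x \<notin> P \<or> y \<notin> Q" "card P = card Q" "\<Union>C \<inter> (P \<union> Q) = {}"
    and "(\<Sum>K\<in>C. card K - 1) + card P = card A + 1"
  shows "real (card A) + 1 \<le> guessing_number s V (insert e E)"
proof -
  have "real ((\<Sum>K\<in>C. card K - 1) + card P) \<le> guessing_number s V (insert e E)"
    by (rule guessing_number_ge_cliques_bipartite[OF finite_V s assms(1,2), where Q = Q])
      (use assms(3-7) AV BV AB in \<open>auto intro!: biclique_edge\<close>)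
  then show ?thesis unfolding assms(8) by simp
qed

text \<open>The new edge closes the triangle on \<open>x\<close>, \<open>y\<close>,
  \<open>z\<close>, worth 2; the other vertices of \<open>A\<close> and \<open>B\<close> are
  matched.\<close>

lemma add_edge_xy: "real (card A) + 1 \<le> guessing_number s V (insert {x, y} E)"
proof (rule guessing_number_insert_ge[where C = "{{x, y, z}}" and P = "A - {x}" and Q = "B - {y}"])
  have "x \<noteq> y" "x \<noteq> z" "y \<noteq> z" using x y z AB by auto
  then show "(\<Sum>K\<in>{{x, y, z}}. card K - 1) + card (A - {x}) = card A + 1"
    using x finite_AB card_gt_0_iff[of A] by auto
qed (use x y z AV BV AB finite_AB card_AB subdivision_edges in \<open>auto intro!: clique_triangle\<close>)

text \<open>Choosing \<open>w\<close> different from \<open>y\<close> makes it adjacent to both ends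
  of the new edge, even if one is \<open>x\<close>. The triangle is worth 2, the edge from
  \<open>y\<close> to \<open>z\<close> 1, and the rest \<open>card A - 2\<close>.\<close>

lemma add_edge_A:
  assumes "u \<in> A" "v \<in> A" "u \<noteq> v"
  shows "real (card A) + 1 \<le> guessing_number s V (insert {u, v} E)"
proof -
  have 2: "card A \<ge> 2" using card_mono[of A "{u, v}"] assms finite_AB by auto
  then obtain w where w: "w \<in> B" "w \<noteq> y" by (rule obtain_other)
  have neq: "w \<notin> A" "y \<notin> A" "w \<noteq> z" "y \<noteq> z" "z \<noteq> u" "z \<noteq> v" "w \<noteq> u" "w \<noteq> v" "y \<noteq> u" "y \<noteq> v"
    using w x y z AB assms by auto
  have [simp]: "card (A - {u, v}) = card A - 2" "card (B - {w, y}) = card A - 2"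
    using assms w y finite_AB card_AB by (simp_all add: card_Diff_subset)
  have ne: "{u, v, w} \<noteq> {y, z}" using neq by auto
  show ?thesis
  proof (rule guessing_number_insert_ge[where C = "{{u, v, w}, {y, z}}" and P = "A - {u, v}"
        and Q = "B - {w, y}"])
    show "(\<Sum>K\<in>{{u, v, w}, {y, z}}. card K - 1) + card (A - {u, v}) = card A + 1"
      using neq ne assms 2 by simp
    show "disjoint {{u, v, w}, {y, z}}" using neq w by (auto simp: disjoint_def)
    fix K assume "K \<in> {{u, v, w}, {y, z}}"
    then show "K \<subseteq> V \<and> K \<noteq> {} \<and> clique (insert {u, v} E) K"
      using assms w y z AV BV
      by (auto intro!: clique_triangle clique_pair subdivision_edges biclique_edge)
  qed (use neq w y z AB assms in auto)
qed

text \<open>The triangle on \<open>z\<close>, \<open>u\<close>, \<open>y\<close> is worth 2, and the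
  matching of the rest avoids \<open>y\<close>, hence the missing edge.\<close>

lemma add_edge_zA:
  assumes "u \<in> A" "u \<noteq> x"
  shows "real (card A) + 1 \<le> guessing_number s V (insert {z, u} E)"
proof (rule guessing_number_insert_ge[where C = "{{z, u, y}}" and P = "A - {u}" and Q = "B - {y}"])
  have "u \<noteq> y" "u \<noteq> z" "y \<noteq> z" using assms y z AB by auto
  then show "(\<Sum>K\<in>{{z, u, y}}. card K - 1) + card (A - {u}) = card A + 1"
    using assms finite_AB card_gt_0_iff[of A] by auto
  fix K assume "K \<in> {{z, u, y}}"
  moreover have "{z, y} \<in> E" using subdivision_edges by (simp add: insert_commute)
  ultimately show "K \<subseteq> V \<and> K \<noteq> {} \<and> clique (insert {z, u} E) K"
    using assms y z AV BV biclique_edge[of u y] by (auto intro!: clique_triangle)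
qed (use assms y z AB finite_AB card_AB in auto)

lemma add_edge_outside:
  assumes p: "p \<in> V" "p \<notin> A \<union> B \<union> {z}" and v: "v \<in> V" "v \<noteq> p" "v \<notin> B \<union> {z}"
  shows "real (card A) + 1 \<le> guessing_number s V (insert {p, v} E)"
proof -
  \<comment> \<open>\<open>u\<close> is the vertex of \<open>A\<close> left out of the matching so
    that it balances \<open>B - {y}\<close>: the end \<open>v\<close> of the new edge if that lies
    in \<open>A\<close>, and otherwise \<open>x\<close> as an arbitrary choice.\<close>
  define u where "u = (if v \<in> A then v else x)"
  have u: "u \<in> A" using x by (simp add: u_def)
  have neq: "p \<noteq> y" "p \<noteq> z" "v \<noteq> y" "v \<noteq> z" "y \<noteq> z" using p v y z by auto
  have ne: "{p, v} \<noteq> {y, z}" using neq by auto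
  have card_u: "card (A - {u}) = card A - 1" "card A > 0"
    using u finite_AB card_gt_0_iff[of A] by auto
  show ?thesis
  proof (rule guessing_number_insert_ge[where C = "{{p, v}, {y, z}}" and P = "A - {u}" and Q = "B - {y}"])
    show "(\<Sum>K\<in>{{p, v}, {y, z}}. card K - 1) + card (A - {u}) = card A + 1"
      using neq ne v card_u by simp
    show "disjoint {{p, v}, {y, z}}" using neq by (auto simp: disjoint_def)
    show "\<Union>{{p, v}, {y, z}} \<inter> (A - {u} \<union> (B - {y})) = {}"
      using p v y z AB by (auto simp: u_def)
    show "card (A - {u}) = card (B - {y})" using u y finite_AB card_AB by simp
    fix K assume "K \<in> {{p, v}, {y, z}}"
    then show "K \<subseteq> V \<and> K \<noteq> {} \<and> clique (insert {p, v} E) K"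
      using p v y z BV by (auto intro!: clique_pair subdivision_edges)
  qed auto
qed

text \<open>As \<open>z\<close> is matched to \<open>p\<close>, the vertices \<open>x\<close> and
  \<open>y\<close> need partners \<open>w\<close> and \<open>u\<close> on the opposite sides, which
  exist because \<open>card A \<ge> 2\<close>. These three edges and \<open>card A - 2\<close>
  further ones form a matching.\<close>

lemma add_edge_outside_z:
  assumes p: "p \<in> V" "p \<notin> A \<union> B \<union> {z}" and 2: "card A \<ge> 2"
  shows "real (card A) + 1 \<le> guessing_number s V (insert {p, z} E)"
proof -
  obtain w where w: "w \<in> B" "w \<noteq> y" using 2 by (rule obtain_other)
  obtain u where u: "u \<in> A" "u \<noteq> x"
    using subdivided_biclique_graph.obtain_other[OF swapped] 2 card_AB by metis
  have neq: "p \<noteq> z" "p \<noteq> x" "p \<noteq> y" "p \<noteq> u" "p \<noteq> w" "z \<noteq> x" "z \<noteq> y" "z \<noteq> u" "z \<noteq> w"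
      "x \<noteq> y" "x \<noteq> w" "u \<noteq> y" "u \<noteq> w" "x \<notin> B" "u \<notin> B" "y \<notin> A" "w \<notin> A"
    using p w u x y z AB by auto
  let ?C = "{{p, z}, {x, w}, {u, y}}"
  have ne: "{p, z} \<noteq> {x, w}" "{p, z} \<noteq> {u, y}" "{x, w} \<noteq> {u, y}"
    using neq w u by (auto simp: doubleton_eq_iff)
  have [simp]: "card (A - {x, u}) = card A - 2" "card (B - {y, w}) = card A - 2"
    using u x w y finite_AB card_AB by (simp_all add: card_Diff_subset)
  show ?thesis
  proof (rule guessing_number_insert_ge[where C = ?C and P = "A - {x, u}" and Q = "B - {y, w}"])
    show "(\<Sum>K\<in>?C. card K - 1) + card (A - {x, u}) = card A + 1"
      using neq ne 2 by simp
    show "disjoint ?C" using neq w u by (auto simp: disjoint_def)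
    show "\<Union>?C \<inter> (A - {x, u} \<union> (B - {y, w})) = {}" using p neq z by auto
    fix K assume "K \<in> ?C"
    then show "K \<subseteq> V \<and> K \<noteq> {} \<and> clique (insert {p, z} E) K"
      using p u w x y z AV BV by (auto intro!: clique_pair biclique_edge)
  qed auto
qed

text \<open>Mirror images of the results for \<open>A\<close>; folding with \<open>card_AB\<close>
  also restores \<open>card A\<close> in the bound.\<close>

lemmas add_edge_B = subdivided_biclique_graph.add_edge_A
  [OF swapped, folded subdivided_biclique_commute[of A B x y z] card_AB]

lemmas add_edge_zB = subdivided_biclique_graph.add_edge_zA
  [OF swapped, folded subdivided_biclique_commute[of A B x y z] card_AB]

lemmas add_edge_outside' = subdivided_biclique_graph.add_edge_outside
  [OF swapped, folded subdivided_biclique_commute[of A B x y z] card_AB]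

section \<open>Saturation and the resulting bound\<close>

lemma gn_saturated:
  assumes 2: "card A \<ge> 2"
  shows "gn_saturated s (real (card A) + 1) V E"
  unfolding gn_saturated_def
proof (intro conjI ballI)
  show "guessing_number s V E < real (card A) + 1"
    using guessing_number_less[OF finite_V s, of "card A + 1" E] num_fixed_points_less by simp
next
  fix e assume "e \<in> nonedges V E"
  then obtain u v where e: "e = {u, v}" "u \<noteq> v" "u \<in> V" "v \<in> V" "{u, v} \<notin> E"
    by (auto simp: nonedges_def card_2_iff)
  let ?goal = "\<lambda>u v. real (card A) + 1 \<le> guessing_number s V (insert {u, v} E)"
  have outside: "?goal p v" if "p \<in> V" "v \<in> V" "p \<noteq> v" "p \<notin> A \<union> B \<union> {z}" for p v
  proof -
    \<comment> \<open>Since \<open>A\<close> and \<open>B\<close> are disjoint, a vertex other than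
      \<open>z\<close> misses at least one of them, so the lemma or its mirror image
      applies.\<close>
    consider "v = z" | "v \<notin> B \<union> {z}" | "v \<notin> A \<union> {z}" using AB by blast
    then show ?thesis
    proof cases
      case 1
      then show ?thesis using add_edge_outside_z that 2 by blast
    next
      case 2
      then show ?thesis using add_edge_outside[of p v] that by auto
    next
      case 3
      then show ?thesis using add_edge_outside'[of p v] that by auto
    qed
  qed
  have at_z: "?goal z v" if "{z, v} \<notin> E" "v \<in> A \<union> B" for v
    using that add_edge_zA[of v] add_edge_zB[of v] subdivision_edges
    by (cases "v = x \<or> v = y") (auto simp: insert_commute)
  have cross: "?goal u v" if "{u, v} \<notin> E" "u \<in> A" "v \<in> B" for u v
    using that add_edge_xy biclique_edge[of u v] by (cases "u = x \<and> v = y") auto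
  consider "u \<notin> A \<union> B \<union> {z}" | "v \<notin> A \<union> B \<union> {z}" | "u = z" "v \<in> A \<union> B" | "v = z" "u \<in> A \<union> B"
    | "u \<in> A" "v \<in> A" | "u \<in> B" "v \<in> B" | "u \<in> A" "v \<in> B" | "v \<in> A" "u \<in> B"
    using e(2) by blast
  then have "?goal u v"
  proof cases
    case 1
    then show ?thesis using outside e by blast
  next
    case 2
    then show ?thesis using outside[of v u] e by (metis insert_commute)
  next
    case 3
    then show ?thesis using at_z e by blast
  next
    case 4
    then show ?thesis using at_z[of u] e by (metis insert_commute)
  next
    case 5
    then show ?thesis using add_edge_A e by blast
  next
    case 6
    then show ?thesis using add_edge_B e by blast
  next
    case 7
    then show ?thesis using cross e by blast
  next
    case 8
    then show ?thesis using cross[of v u] e by (metis insert_commute)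
  qed
  then show "real (card A) + 1 \<le> guessing_number s V (insert e E)" by (simp add: e(1))
qed

end

theorem theorem4p7:
  fixes a s n :: nat
  assumes "a \<ge> 2" and "s \<ge> 2" and "n \<ge> 2 * a + 1"
  shows "sat_number n s (real a + 1) \<le> enat (a\<^sup>2 + 1)"
proof -
  \<comment> \<open>The sides are the first two blocks of \<open>a\<close> numbers, and
    \<open>2 * a\<close> subdivides; it is a vertex because
    \<open>n \<ge> 2 * a + 1\<close>.\<close>
  interpret G: subdivided_biclique_graph "{..<n}" "{..<a}" "{a..<2 * a}" 0 a "2 * a" s
    using assms by unfold_locales auto
  have "sat_number n s (real a + 1) \<le> enat (card G.E)"
    unfolding sat_number_def
    using G.simple_graph G.gn_saturated assms(1) by (intro Inf_lower) (auto intro!: exI)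
  also have "card G.E \<le> a\<^sup>2 + 1"
    using card_subdivided_biclique_le[OF G.finite_AB G.x G.y, of "2 * a"]
    by (simp add: power2_eq_square)
  finally show ?thesis by simp
qed

end
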